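(* Let $B$ be the backward shift on $\ell^2(\mathbb N_0)$, defined by $B(x_0,x_1,x_2,\dots)=(x_1,x_2,x_3,\dots)$, and let $\lambda\in\mathbb C$ with $|\lambda|>1$. Set $T:=\lambda B$, and let $d$ be the metric induced by the usual Hilbert norm on $\ell^2(\mathbb N_0)$. Then for every $\delta>0$, the operator $T$ satisfies the $\delta$-Hypercyclicity Criterion with respect to the sequence $n_k=k$. In particular, $T$ is $\delta$-hypercyclic for every $\delta>0$.
   Context: $\mathbb N_0=\{0,1,2,\dots\}$ and $\ell^2(\mathbb N_0)$ is the complex Hilbert space of square-summable sequences. Let $X$ be a separable topological vector space equipped with a translation-invariant metric $d$ generating its topology, $T:X\to X$ a continuous linear operator, and $\delta>0$. $T$ satisfies the $\delta$-Hypercyclicity Criterion with respect to a strictly increasing sequence $(n_k)$ of (nonnegative) integers if there exist dense subsets $V,W\subset X$ and maps $S_{n_k}:W\to X$ (not assumed linear or continuous) such that: (1) for every $v\in V$, $T^{n_k}v\to0$; (2) for every $w\in W$, $S_{n_k}w\to0$; (3) for every $w\in W$ there exists $k_0\in\mathbb N$ such that $d(T^{n_k}(S_{n_k}w),w)<\delta$ for all $k\ge k_0$. $T$ is $\delta$-hypercyclic if there exists $x\in X$ whose forward orbit $\{T^nx:n\ge0\}$ is $\delta$-dense in $X$, meaning that for every nonempty open set $O\subset X$ there exists $n\ge0$ with $T^nx\in B_\delta(O)$, where $B_\delta(O):=\{x\in X:\inf_{y\in O}d(x,y)<\delta\}$. *)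

theory Defs
  imports "HOL-Analysis.Analysis"
begin

section \<open>Delta-hypercyclic operators\<close>

text \<open>Type class \<open>metric_space\<close> supplies the metric \<open>dist\<close> together with the topology it generates.\<close>

locale separable_metric_tvs = vector_space scale
  for scale :: "complex \<Rightarrow> 'a::{ab_group_add, metric_space} \<Rightarrow> 'a" +
  assumes continuous_add: "continuous_on UNIV (\<lambda>(x::'a, y). x + y)"
    and continuous_scale: "continuous_on UNIV (\<lambda>(c, x). scale c x)"
    and dist_translation_invariant: "dist (x + z) (y + z) = dist x (y::'a)"
    and separable: "\<exists>D::'a set. countable D \<and> closure D = UNIV"
begin

definition continuous_linear_operator :: "('a \<Rightarrow> 'a) \<Rightarrow> bool" where
  "continuous_linear_operator T \<longleftrightarrow>
     Vector_Spaces.linear scale scale T \<and> continuous_on UNIV T"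

text \<open>The map written \<open>S\<close> with subscript \<open>n\<^sub>k\<close> is \<open>S (n k)\<close>; only its values on \<open>W\<close> matter.\<close>

definition delta_hypercyclicity_criterion :: "real \<Rightarrow> ('a \<Rightarrow> 'a) \<Rightarrow> (nat \<Rightarrow> nat) \<Rightarrow> bool" where
  "delta_hypercyclicity_criterion \<delta> T n \<longleftrightarrow>
     continuous_linear_operator T \<and> strict_mono n \<and>
     (\<exists>V W. \<exists>S :: nat \<Rightarrow> 'a \<Rightarrow> 'a.
        closure V = UNIV \<and> closure W = UNIV \<and>
        (\<forall>v\<in>V. (\<lambda>k. (T ^^ n k) v) \<longlonglongrightarrow> 0) \<and>
        (\<forall>w\<in>W. (\<lambda>k. S (n k) w) \<longlonglongrightarrow> 0) \<and>
        (\<forall>w\<in>W. \<exists>k0. \<forall>k\<ge>k0. dist ((T ^^ n k) (S (n k) w)) w < \<delta>))"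

definition delta_neighbourhood :: "real \<Rightarrow> 'a set \<Rightarrow> 'a set" where
  "delta_neighbourhood \<delta> U = {x. (INF y\<in>U. dist x y) < \<delta>}"

definition delta_dense :: "real \<Rightarrow> 'a set \<Rightarrow> bool" where
  "delta_dense \<delta> A \<longleftrightarrow>
     (\<forall>U. open U \<longrightarrow> U \<noteq> {} \<longrightarrow> A \<inter> delta_neighbourhood \<delta> U \<noteq> {})"

definition delta_hypercyclic :: "real \<Rightarrow> ('a \<Rightarrow> 'a) \<Rightarrow> bool" where
  "delta_hypercyclic \<delta> T \<longleftrightarrow>
     continuous_linear_operator T \<and> (\<exists>x. delta_dense \<delta> (range (\<lambda>n. (T ^^ n) x)))"

end


section \<open>The space of square-summable complex sequences\<close>

typedef ell2 = "{x :: nat \<Rightarrow> complex. summable (\<lambda>n. (cmod (x n))\<^sup>2)}"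
  morphisms coords Abs_ell2
  by (rule exI[of _ "\<lambda>_. 0"]) simp

setup_lifting type_definition_ell2

lemma square_summable_add_aux:
  fixes x y :: "nat \<Rightarrow> complex"
  assumes x: "summable (\<lambda>n. (cmod (x n))\<^sup>2)" and y: "summable (\<lambda>n. (cmod (y n))\<^sup>2)"
  shows "summable (\<lambda>n. (cmod (x n + y n))\<^sup>2)"
    and "sqrt (\<Sum>n. (cmod (x n + y n))\<^sup>2) \<le>
           sqrt (\<Sum>n. (cmod (x n))\<^sup>2) + sqrt (\<Sum>n. (cmod (y n))\<^sup>2)"
proof -
  let ?C = "sqrt (\<Sum>n. (cmod (x n))\<^sup>2) + sqrt (\<Sum>n. (cmod (y n))\<^sup>2)"
  have C0: "?C \<ge> 0" by (simp add: suminf_nonneg x y)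
  have bound: "(\<Sum>i<n. (cmod (x i + y i))\<^sup>2) \<le> ?C\<^sup>2" for n
  proof -
    have "L2_set (\<lambda>i. cmod (x i + y i)) {..<n} \<le> L2_set (\<lambda>i. cmod (x i) + cmod (y i)) {..<n}"
      by (rule L2_set_mono) (auto intro: norm_triangle_ineq)
    also have "\<dots> \<le> L2_set (\<lambda>i. cmod (x i)) {..<n} + L2_set (\<lambda>i. cmod (y i)) {..<n}"
      by (rule L2_set_triangle_ineq)
    also have "\<dots> \<le> ?C"
      unfolding L2_set_def
      by (intro add_mono real_sqrt_le_mono sum_le_suminf x y) auto
    finally have "L2_set (\<lambda>i. cmod (x i + y i)) {..<n} \<le> ?C" .
    then show ?thesis unfolding L2_set_def
      by (rule sqrt_le_D)
  qed
  show s: "summable (\<lambda>n. (cmod (x n + y n))\<^sup>2)"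
    by (rule summableI_nonneg_bounded[where x = "?C\<^sup>2"]) (use bound in auto)
  have "(\<Sum>n. (cmod (x n + y n))\<^sup>2) \<le> ?C\<^sup>2"
    by (rule suminf_le_const[OF s]) (use bound in auto)
  then show "sqrt (\<Sum>n. (cmod (x n + y n))\<^sup>2) \<le> ?C"
    using C0 real_le_lsqrt by blast
qed

lemma square_summable_scale_aux:
  fixes x :: "nat \<Rightarrow> complex"
  assumes "summable (\<lambda>n. (cmod (x n))\<^sup>2)"
  shows "summable (\<lambda>n. (cmod (c * x n))\<^sup>2)"
  using assms by (simp add: norm_mult power_mult_distrib summable_mult)

instantiation ell2 :: ab_group_add
begin

lift_definition zero_ell2 :: ell2 is "\<lambda>_. 0" by simp
lift_definition plus_ell2 :: "ell2 \<Rightarrow> ell2 \<Rightarrow> ell2" is "\<lambda>x y n. x n + y n"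
  by (rule square_summable_add_aux)
lift_definition uminus_ell2 :: "ell2 \<Rightarrow> ell2" is "\<lambda>x n. - x n" by simp
lift_definition minus_ell2 :: "ell2 \<Rightarrow> ell2 \<Rightarrow> ell2" is "\<lambda>x y n. x n - y n"
  using square_summable_add_aux(1)[of _ "\<lambda>n. - _ n"] by simp

instance
  by standard (transfer; simp add: fun_eq_iff algebra_simps)+

end

lift_definition scale_ell2 :: "complex \<Rightarrow> ell2 \<Rightarrow> ell2" is "\<lambda>c x n. c * x n"
  by (rule square_summable_scale_aux)

lift_definition backward_shift :: "ell2 \<Rightarrow> ell2" is "\<lambda>x n. x (Suc n)"
  by (subst summable_Suc_iff)

instantiation ell2 :: real_normed_vector
begin

definition scaleR_ell2 :: "real \<Rightarrow> ell2 \<Rightarrow> ell2" where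
  "scaleR_ell2 r x = scale_ell2 (complex_of_real r) x"
definition norm_ell2 :: "ell2 \<Rightarrow> real" where
  "norm_ell2 x = sqrt (\<Sum>n. (cmod (coords x n))\<^sup>2)"
definition sgn_ell2 :: "ell2 \<Rightarrow> ell2" where
  "sgn_ell2 x = inverse (norm x) *\<^sub>R x"
definition dist_ell2 :: "ell2 \<Rightarrow> ell2 \<Rightarrow> real" where
  "dist_ell2 x y = norm (x - y)"
definition uniformity_ell2 :: "(ell2 \<times> ell2) filter" where
  "uniformity_ell2 = (INF e\<in>{0<..}. principal {(x, y). dist x y < e})"
definition open_ell2 :: "ell2 set \<Rightarrow> bool" where
  "open_ell2 U \<longleftrightarrow> (\<forall>x\<in>U. \<forall>\<^sub>F (x', y) in uniformity. x' = x \<longrightarrow> y \<in> U)"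

lemma norm_scale_ell2: "norm (scale_ell2 c x) = cmod c * norm x"
  unfolding norm_ell2_def
  by transfer (simp add: norm_mult power_mult_distrib suminf_mult real_sqrt_mult)

instance
proof
  fix x y :: ell2 and a b :: real
  show "a *\<^sub>R (x + y) = a *\<^sub>R x + a *\<^sub>R y"
    unfolding scaleR_ell2_def by transfer (simp add: fun_eq_iff algebra_simps)
  show "(a + b) *\<^sub>R x = a *\<^sub>R x + b *\<^sub>R x"
    unfolding scaleR_ell2_def by transfer (simp add: fun_eq_iff algebra_simps)
  show "a *\<^sub>R b *\<^sub>R x = (a * b) *\<^sub>R x"
    unfolding scaleR_ell2_def by transfer (simp add: fun_eq_iff algebra_simps)
  show "1 *\<^sub>R x = x"
    unfolding scaleR_ell2_def by transfer (simp add: fun_eq_iff)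
  show "norm x = 0 \<longleftrightarrow> x = 0"
    unfolding norm_ell2_def by transfer (auto simp: suminf_eq_zero_iff fun_eq_iff)
  show "norm (x + y) \<le> norm x + norm y"
    unfolding norm_ell2_def by transfer (rule square_summable_add_aux)
  show "norm (a *\<^sub>R x) = \<bar>a\<bar> * norm x"
    by (simp add: scaleR_ell2_def norm_scale_ell2)
qed (rule dist_ell2_def sgn_ell2_def uniformity_ell2_def open_ell2_def)+

end

lemma vector_space_scale_ell2: "vector_space scale_ell2"
  by standard (transfer; simp add: fun_eq_iff algebra_simps)+

lift_definition ell2_of_list :: "complex list \<Rightarrow> ell2" is
  "\<lambda>xs n. if n < length xs then xs ! n else 0"
  subgoal for xs
    by (rule summable_finite[of "{..<length xs}"]) auto
  done

lemma separable_ell2: "\<exists>D::ell2 set. countable D \<and> closure D = UNIV"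
proof -
  obtain Q :: "complex set" where Q: "countable Q"
    and Qd: "\<And>U. open U \<Longrightarrow> U \<noteq> {} \<Longrightarrow> \<exists>q\<in>Q. q \<in> U"
    using countable_dense_setE by blast
  have "\<exists>y\<in>ell2_of_list ` lists Q. dist y x < e" if e: "e > 0" for x and e :: real
  proof -
    have sx: "summable (\<lambda>n. (cmod (coords x n))\<^sup>2)"
      using coords[of x] by simp
    have e2: "e\<^sup>2 / 2 > 0" using e by simp
    obtain N where N: "\<And>n. n \<ge> N \<Longrightarrow> norm (\<Sum>i. (cmod (coords x (i + n)))\<^sup>2) < e\<^sup>2 / 2"
      using suminf_exist_split[OF e2 sx] by blast
    define \<eta> where "\<eta> = e / (2 * (real N + 1))"
    have \<eta>: "\<eta> > 0" using e by (simp add: \<eta>_def)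
    have "\<exists>q\<in>Q. cmod (q - coords x i) < \<eta>" for i
      using Qd[of "ball (coords x i) \<eta>"] \<eta> by (auto simp: dist_norm norm_minus_commute)
    then obtain q where qQ: "\<And>i. q i \<in> Q" and q: "\<And>i. cmod (q i - coords x i) < \<eta>"
      by metis
    define y where "y = ell2_of_list (map q [0..<N])"
    have cy: "coords (y - x) i = (if i < N then q i - coords x i else - coords x i)" for i
      unfolding y_def by (simp add: minus_ell2.rep_eq ell2_of_list.rep_eq)
    have sy: "summable (\<lambda>n. (cmod (coords (y - x) n))\<^sup>2)"
      using coords[of "y - x"] by simp
    have "(\<Sum>i. (cmod (coords (y - x) i))\<^sup>2) =
        (\<Sum>i. (cmod (coords (y - x) (i + N)))\<^sup>2) + (\<Sum>i<N. (cmod (coords (y - x) i))\<^sup>2)"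
      by (rule suminf_split_initial_segment[OF sy])
    also have "(\<Sum>i. (cmod (coords (y - x) (i + N)))\<^sup>2) < e\<^sup>2 / 2"
      using N[of N] by (simp add: cy)
    also have "(\<Sum>i<N. (cmod (coords (y - x) i))\<^sup>2) \<le> (\<Sum>i<N. \<eta>\<^sup>2)"
      by (rule sum_mono) (simp add: cy power_mono less_imp_le[OF q])
    also have "(\<Sum>i<N. \<eta>\<^sup>2) \<le> e\<^sup>2 / 2"
    proof -
      have "real N * 2 \<le> (2 * (real N + 1))\<^sup>2"
        by (simp add: power2_eq_square algebra_simps)
      then show ?thesis
        using e by (simp add: \<eta>_def power_divide divide_simps mult_left_mono)
    qed
    finally have "(\<Sum>i. (cmod (coords (y - x) i))\<^sup>2) < e\<^sup>2" by simp
    then have "norm (y - x) < e"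
      unfolding norm_ell2_def using e by (intro real_less_lsqrt) auto
    moreover have "y \<in> ell2_of_list ` lists Q"
      unfolding y_def using qQ by (intro imageI) auto
    ultimately show ?thesis by (auto simp: dist_norm)
  qed
  then have "closure (ell2_of_list ` lists Q) = UNIV"
    by (auto simp: closure_approachable)
  moreover have "countable (ell2_of_list ` lists Q)"
    using Q by simp
  ultimately show ?thesis by blast
qed

lemma continuous_scale_ell2: "continuous_on UNIV (\<lambda>(c, x). scale_ell2 c x)"
proof -
  interpret vector_space scale_ell2 by (rule vector_space_scale_ell2)
  have "bounded_bilinear scale_ell2"
  proof
    show "scale_ell2 (r *\<^sub>R a) b = r *\<^sub>R scale_ell2 a b"
      "scale_ell2 a (r *\<^sub>R b) = r *\<^sub>R scale_ell2 a b" for r a b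
      by (simp_all add: scaleR_ell2_def scaleR_conv_of_real mult.commute)
    show "\<exists>K. \<forall>a b. norm (scale_ell2 a b) \<le> norm a * norm b * K"
      by (rule exI[of _ 1]) (simp add: norm_scale_ell2)
  qed (auto simp: scale_left_distrib scale_right_distrib)
  then show ?thesis
    unfolding case_prod_unfold
    by (rule bounded_bilinear.continuous_on) (auto intro!: continuous_intros)
qed

global_interpretation ell2: separable_metric_tvs scale_ell2
proof (intro separable_metric_tvs.intro vector_space_scale_ell2 separable_metric_tvs_axioms.intro)
  show "continuous_on UNIV (\<lambda>(x::ell2, y). x + y)"
    unfolding case_prod_unfold by (intro continuous_intros)
next
  fix x z y :: ell2
  show "dist (x + z) (y + z) = dist x y"
    by (simp add: dist_norm)
qed (fact continuous_scale_ell2 separable_ell2)+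

end

theory Submission imports Defs begin

text \<open>
  Write \<open>T\<close> for \<open>lam\<close> times the backward shift and \<open>S\<close> for \<open>1 / lam\<close> times the forward shift. Then
  \<open>T \<circ> S\<close> is the identity, the norm of \<open>S\<^sup>n w\<close> is \<open>cmod lam\<close> to the power \<open>-n\<close> times the norm of \<open>w\<close>
  (\<open>norm_scaled_forward_shift_power\<close>), and \<open>T\<^sup>n\<close> eventually vanishes at every truncated sequence
  (\<open>scaled_backward_shift_power_truncation\<close>). Truncated sequences are dense, so the criterion holds,
  with an error in its third condition that is exactly \<open>0\<close>.

  An orbit that comes within \<open>\<epsilon>\<close> of every element \<open>w\<^sub>0, w\<^sub>1, \<dots>\<close> of a countable dense set of
  truncated sequences is that of \<open>x = (\<Sum>i. S\<^bsup>n i\<^esup> w\<^sub>i)\<close>, for exponents \<open>n i\<close> with large gaps: applying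
  \<open>T\<^bsup>n j\<^esup>\<close> turns the \<open>j\<close>-th summand into \<open>w\<^sub>j\<close>, an earlier summand \<open>i < j\<close> into \<open>T\<^bsup>n j - n i\<^esup> w\<^sub>i\<close>
  and a later one \<open>i > j\<close> into \<open>S\<^bsup>n i - n j\<^esup> w\<^sub>i\<close>, and all of these are small. The argument is given
  for an operator on an arbitrary Banach space (\<open>approximating_orbit_exists\<close>); applying it requires
  the completeness of the sequence space.
\<close>

section \<open>Orbits approximating a countable set\<close>

lemma bounded_linear_funpow:
  fixes T :: "'a::real_normed_vector \<Rightarrow> 'a"
  assumes "bounded_linear T"
  shows "bounded_linear (T ^^ n)"
proof (induction n)
  case 0
  then show ?case by (simp add: id_def bounded_linear_ident)
next
  case (Suc n)
  then show ?case using bounded_linear_compose[OF assms Suc] by (simp add: comp_def)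
qed

lemma funpow_right_inverse:
  fixes T S :: "'a \<Rightarrow> 'a"
  assumes "\<And>x. T (S x) = x"
  shows "(T ^^ n) ((S ^^ n) x) = x"
proof (induction n arbitrary: x)
  case (Suc n)
  then show ?case by (simp add: funpow_swap1[of S] assms)
qed simp

lemma approximating_orbit_exists:
  fixes T S :: "'a::banach \<Rightarrow> 'a"
  assumes T: "bounded_linear T"
    and TS: "\<And>x. T (S x) = x"
    and D: "countable D"
    and T0: "\<And>w. w \<in> D \<Longrightarrow> (\<lambda>n. (T ^^ n) w) \<longlonglongrightarrow> 0"
    and S0: "\<And>w. w \<in> D \<Longrightarrow> (\<lambda>n. (S ^^ n) w) \<longlonglongrightarrow> 0"
    and \<epsilon>: "\<epsilon> > 0"
  shows "\<exists>x. \<forall>w\<in>D. \<exists>n. dist ((T ^^ n) x) w \<le> \<epsilon>"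
proof (cases "D = {}")
  case False
  define w where "w = from_nat_into D"
  have wD: "w i \<in> D" for i
    unfolding w_def using False by (rule from_nat_into)
  \<comment> \<open>These tolerances sum to \<open>\<epsilon>\<close>.\<close>
  define e where "e i = \<epsilon> * (1/2) ^ Suc i" for i :: nat
  have e: "e i > 0" for i
    using \<epsilon> by (simp add: e_def)
  have e_sums: "e sums \<epsilon>"
    unfolding e_def using sums_mult[OF power_half_series, of \<epsilon>] by simp
  have "\<exists>N. \<forall>k\<ge>N. norm ((T ^^ k) (w i)) \<le> e i \<and> norm ((S ^^ k) (w i)) \<le> e i" for i
  proof -
    have "\<forall>\<^sub>F k in sequentially. norm ((T ^^ k) (w i)) < e i"
      and "\<forall>\<^sub>F k in sequentially. norm ((S ^^ k) (w i)) < e i"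
      using tendstoD[OF T0[OF wD[of i]] e[of i]] tendstoD[OF S0[OF wD[of i]] e[of i]]
      by (simp_all add: dist_norm)
    then have "\<forall>\<^sub>F k in sequentially. norm ((T ^^ k) (w i)) \<le> e i \<and> norm ((S ^^ k) (w i)) \<le> e i"
      by eventually_elim simp
    then show ?thesis by (simp add: eventually_sequentially)
  qed
  then obtain N where NT: "\<And>i k. k \<ge> N i \<Longrightarrow> norm ((T ^^ k) (w i)) \<le> e i"
    and NS: "\<And>i k. k \<ge> N i \<Longrightarrow> norm ((S ^^ k) (w i)) \<le> e i"
    by metis
  \<comment> \<open>For \<open>i < j\<close> the gap \<open>n j - n i\<close> is then at least both \<open>N i\<close> and \<open>N j\<close>.\<close>
  define n where "n j = N 0 + (\<Sum>k<j. N k + N (Suc k))" for j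
  have n_Suc: "n (Suc k) = n k + N k + N (Suc k)" for k
    by (simp add: n_def)
  have n_mono: "n i \<le> n j" if "i \<le> j" for i j
    by (rule lift_Suc_mono_le[OF _ that]) (simp add: n_Suc)
  have gap_left: "n i + N i \<le> n j" if "i < j" for i j
    using n_mono[of "Suc i" j] that n_Suc[of i] by simp
  have gap_right: "n i + N j \<le> n j" if "i < j" for i j
  proof -
    from that obtain m where "j = Suc m" "i \<le> m" by (cases j) auto
    then show ?thesis using n_mono[of i m] n_Suc[of m] by simp
  qed
  have n_ge: "N i \<le> n i" for i
    by (cases i) (simp_all add: n_def)
  \<comment> \<open>The bound depends on the summand \<open>i\<close> only, so it can be summed over \<open>i\<close> for each fixed \<open>j\<close>.\<close>
  have shifted: "norm ((T ^^ n j) ((S ^^ n i) (w i))) \<le> e i" if "i \<noteq> j" for i j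
  proof (cases "i < j")
    case True
    then have "n j = (n j - n i) + n i" using n_mono[of i j] by simp
    then have "(T ^^ n j) ((S ^^ n i) (w i)) = (T ^^ (n j - n i)) (w i)"
      using funpow_right_inverse[of T S "n i" "w i"] TS
      by (metis comp_apply funpow_add)
    then show ?thesis using NT[of i "n j - n i"] gap_left[OF True] by simp
  next
    case False
    then have "j < i" using that by simp
    then have "n i = n j + (n i - n j)" using n_mono[of j i] by simp
    then have "(T ^^ n j) ((S ^^ n i) (w i)) = (S ^^ (n i - n j)) (w i)"
      using funpow_right_inverse[of T S "n j" "(S ^^ (n i - n j)) (w i)"] TS
      by (metis comp_apply funpow_add)
    then show ?thesis using NS[of i "n i - n j"] gap_right[OF \<open>j < i\<close>] by simp
  qed
  define x where "x = (\<Sum>i. (S ^^ n i) (w i))"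
  have "summable (\<lambda>i. (S ^^ n i) (w i))"
    by (rule summable_comparison_test'[OF sums_summable[OF e_sums]]) (rule NS[OF n_ge])
  then have x_sums: "(\<lambda>i. (S ^^ n i) (w i)) sums x"
    unfolding x_def by (rule summable_sums)
  have "dist ((T ^^ n j) x) (w j) \<le> \<epsilon>" for j
  proof -
    define g where "g i = (T ^^ n j) ((S ^^ n i) (w i)) - (if i = j then w i else 0)" for i
    have "g sums ((T ^^ n j) x - w j)"
      unfolding g_def
      by (intro sums_diff sums_single bounded_linear.sums[OF bounded_linear_funpow[OF T]] x_sums)
    moreover have "norm (g i) \<le> e i" for i
      using shifted[of i j] e[of i] funpow_right_inverse[of T S, OF TS]
      by (auto simp: g_def less_imp_le)
    ultimately have "norm ((T ^^ n j) x - w j) \<le> suminf e"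
      using norm_suminf_le[of g e] sums_summable[OF e_sums] by (simp add: sums_iff)
    then show ?thesis using e_sums by (simp add: dist_norm sums_iff)
  qed
  moreover have "\<exists>j. v = w j" if "v \<in> D" for v
    using from_nat_into_surj[OF D that] by (auto simp: w_def)
  ultimately show ?thesis by metis
qed simp


section \<open>Completeness of the space of square-summable sequences\<close>

lemma summable_coords: "summable (\<lambda>n. (cmod (coords x n))\<^sup>2)"
  using coords[of x] by simp

lemma norm_ell2_power2: "(norm x)\<^sup>2 = (\<Sum>n. (cmod (coords x n))\<^sup>2)"
  by (simp add: norm_ell2_def suminf_nonneg summable_coords)

lemma sum_coords_le_norm: "(\<Sum>k<K. (cmod (coords x k))\<^sup>2) \<le> (norm x)\<^sup>2"
  unfolding norm_ell2_power2 by (rule sum_le_suminf[OF summable_coords]) auto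

lemma cmod_coords_le_norm: "cmod (coords x k) \<le> norm x"
proof -
  have "(cmod (coords x k))\<^sup>2 \<le> (\<Sum>k<Suc k. (cmod (coords x k))\<^sup>2)"
    by (simp add: sum_nonneg)
  then have "(cmod (coords x k))\<^sup>2 \<le> (norm x)\<^sup>2"
    using sum_coords_le_norm[of x "Suc k"] by linarith
  then show ?thesis by (rule power2_le_imp_le) simp
qed

lemma ell2_of_bounded_partial_sums:
  assumes "\<And>K. (\<Sum>k<K. (cmod (y k))\<^sup>2) \<le> e\<^sup>2" and "e \<ge> 0"
  shows "\<exists>z. coords z = y \<and> norm z \<le> e"
proof -
  have s: "summable (\<lambda>k. (cmod (y k))\<^sup>2)"
    by (rule summableI_nonneg_bounded[where x = "e\<^sup>2"]) (use assms in auto)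
  then have c: "coords (Abs_ell2 y) = y" by (simp add: Abs_ell2_inverse)
  have "(norm (Abs_ell2 y))\<^sup>2 \<le> e\<^sup>2"
    unfolding norm_ell2_power2 c by (rule suminf_le_const[OF s]) (use assms in auto)
  then have "norm (Abs_ell2 y) \<le> e" using assms(2) by (rule power2_le_imp_le)
  with c show ?thesis by blast
qed

instance ell2 :: banach
proof
  fix X :: "nat \<Rightarrow> ell2"
  assume X: "Cauchy X"
  have "Cauchy (\<lambda>n. coords (X n) k)" for k
  proof (rule CauchyI)
    fix e :: real assume "e > 0"
    then obtain M where M: "\<forall>m\<ge>M. \<forall>n\<ge>M. norm (X m - X n) < e"
      using X by (blast dest: CauchyD)
    have "cmod (coords (X m) k - coords (X n) k) \<le> norm (X m - X n)" for m n
      using cmod_coords_le_norm[of "X m - X n" k] by (simp add: minus_ell2.rep_eq)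
    then show "\<exists>M. \<forall>m\<ge>M. \<forall>n\<ge>M. norm (coords (X m) k - coords (X n) k) < e"
      using M by (meson le_less_trans)
  qed
  then obtain L where L: "\<And>k. (\<lambda>n. coords (X n) k) \<longlonglongrightarrow> L k"
    unfolding Cauchy_convergent_iff convergent_def by metis
  \<comment> \<open>The coordinatewise limit \<open>L\<close> is not yet known to be square-summable, so the distance from
    \<open>X m\<close> to it is expressed by an element whose coordinates are the difference. One such
    element then shows that \<open>L\<close> is square-summable.\<close>
  have close: "\<exists>M. \<forall>m\<ge>M. \<exists>z. coords z = (\<lambda>k. coords (X m) k - L k) \<and> norm z \<le> e"
    if "e > 0" for e
  proof -
    obtain M where M: "\<And>m n. m \<ge> M \<Longrightarrow> n \<ge> M \<Longrightarrow> norm (X m - X n) < e"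
      using X \<open>e > 0\<close> by (blast dest: CauchyD)
    have "\<exists>z. coords z = (\<lambda>k. coords (X m) k - L k) \<and> norm z \<le> e" if "m \<ge> M" for m
    proof (rule ell2_of_bounded_partial_sums)
      fix K
      have lim: "(\<lambda>n. \<Sum>k<K. (cmod (coords (X m) k - coords (X n) k))\<^sup>2)
          \<longlonglongrightarrow> (\<Sum>k<K. (cmod (coords (X m) k - L k))\<^sup>2)"
        by (intro tendsto_intros L)
      have "(\<Sum>k<K. (cmod (coords (X m) k - coords (X n) k))\<^sup>2) \<le> e\<^sup>2" if "n \<ge> M" for n
      proof -
        have "(\<Sum>k<K. (cmod (coords (X m) k - coords (X n) k))\<^sup>2) \<le> (norm (X m - X n))\<^sup>2"
          using sum_coords_le_norm[where x = "X m - X n"] by (simp add: minus_ell2.rep_eq)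
        also have "\<dots> \<le> e\<^sup>2"
          using M[OF \<open>m \<ge> M\<close> that] by (intro power_mono) auto
        finally show ?thesis .
      qed
      then show "(\<Sum>k<K. (cmod (coords (X m) k - L k))\<^sup>2) \<le> e\<^sup>2"
        by (intro LIMSEQ_le_const2[OF lim]) auto
    qed (use \<open>e > 0\<close> in simp)
    then show ?thesis by blast
  qed
  obtain m z where "coords z = (\<lambda>k. coords (X m) k - L k)"
    using close[of 1] by auto
  then have cY: "coords (X m - z) = L"
    by (simp add: minus_ell2.rep_eq)
  have "X \<longlonglongrightarrow> X m - z"
  proof (rule LIMSEQ_I)
    fix e :: real assume "e > 0"
    then obtain M where M: "\<And>n. n \<ge> M \<Longrightarrow>
        \<exists>z'. coords z' = (\<lambda>k. coords (X n) k - L k) \<and> norm z' \<le> e / 2"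
      using close[of "e / 2"] by auto
    have "norm (X n - (X m - z)) < e" if "n \<ge> M" for n
    proof -
      obtain z' where z': "coords z' = (\<lambda>k. coords (X n) k - L k)" "norm z' \<le> e / 2"
        using M[OF \<open>n \<ge> M\<close>] by blast
      then have "coords z' = coords (X n - (X m - z))"
        by (simp add: minus_ell2.rep_eq[of "X n"] cY)
      then have "z' = X n - (X m - z)" by (simp add: coords_inject)
      with z' \<open>e > 0\<close> show ?thesis by simp
    qed
    then show "\<exists>M. \<forall>n\<ge>M. norm (X n - (X m - z)) < e" by blast
  qed
  then show "convergent X" by (rule convergentI)
qed


section \<open>Truncated sequences\<close>

text \<open>The sequence that agrees with \<open>x\<close> at the indices below \<open>N\<close> and is \<open>0\<close> elsewhere.\<close>

definition truncation :: "nat \<Rightarrow> ell2 \<Rightarrow> ell2" where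
  "truncation N x = ell2_of_list (map (coords x) [0..<N])"

lemma coords_truncation: "coords (truncation N x) k = (if k < N then coords x k else 0)"
  by (simp add: truncation_def ell2_of_list.rep_eq)

lemma truncation_tendsto: "(\<lambda>N. truncation N x) \<longlonglongrightarrow> x"
proof (rule LIMSEQ_I)
  fix e :: real assume e: "e > 0"
  then have "e\<^sup>2 > 0" by simp
  then obtain M where M: "\<And>N. N \<ge> M \<Longrightarrow> norm (\<Sum>i. (cmod (coords x (i + N)))\<^sup>2) < e\<^sup>2"
    using suminf_exist_split[OF _ summable_coords[of x]] by blast
  have "norm (truncation N x - x) < e" if "N \<ge> M" for N
  proof -
    have c: "coords (truncation N x - x) k = (if k < N then 0 else - coords x k)" for k
      by (simp add: minus_ell2.rep_eq coords_truncation)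
    have "(norm (truncation N x - x))\<^sup>2 = (\<Sum>i. (cmod (coords x (i + N)))\<^sup>2)"
      unfolding norm_ell2_power2
      by (subst suminf_split_initial_segment[OF summable_coords, of _ N]) (simp add: c)
    also have "\<dots> < e\<^sup>2" using M[OF that] by simp
    finally show ?thesis using e by (intro power_less_imp_less_base[of _ 2 e]) auto
  qed
  then show "\<exists>M. \<forall>N\<ge>M. norm (truncation N x - x) < e" by blast
qed

lemma countable_dense_truncations:
  obtains D where "countable D" and "closure D = UNIV"
    and "\<And>w. w \<in> D \<Longrightarrow> \<exists>N x. w = truncation N x"
proof -
  obtain E :: "ell2 set" where E: "countable E" "closure E = UNIV"
    using separable_ell2 by blast
  define D where "D = (\<lambda>(N, x). truncation N x) ` (UNIV \<times> E)"
  have "x \<in> closure D" if "x \<in> E" for x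
    using that by (intro Lim_in_closed_set[OF _ _ _ truncation_tendsto])
      (auto simp: D_def intro!: always_eventually closure_subset[THEN subsetD])
  then have "closure E \<subseteq> closure D"
    by (intro closure_minimal) auto
  then have "closure D = UNIV" using E by auto
  moreover have "countable D" using E by (auto simp: D_def)
  ultimately show ?thesis by (intro that[of D]) (auto simp: D_def)
qed


section \<open>Weighted shifts\<close>

text \<open>The isometric right inverse of the backward shift, which puts \<open>0\<close> in front of a sequence.\<close>

lift_definition forward_shift :: "ell2 \<Rightarrow> ell2" is "\<lambda>x n. case n of 0 \<Rightarrow> 0 | Suc m \<Rightarrow> x m"
  by (subst summable_Suc_iff[symmetric]) simp

lemma backward_forward_shift: "backward_shift (forward_shift x) = x"
  by transfer simp

lemma backward_shift_scale: "backward_shift (scale_ell2 c x) = scale_ell2 c (backward_shift x)"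
  by transfer simp

lemma norm_forward_shift: "norm (forward_shift x) = norm x"
proof -
  have "(norm (forward_shift x))\<^sup>2 = (norm x)\<^sup>2"
    unfolding norm_ell2_power2
    using suminf_split_head[OF summable_coords[of "forward_shift x"]]
    by (simp add: forward_shift.rep_eq)
  then show ?thesis by simp
qed

lemma norm_backward_shift_le: "norm (backward_shift x) \<le> norm x"
proof -
  have "(norm (backward_shift x))\<^sup>2 \<le> (norm x)\<^sup>2"
    unfolding norm_ell2_power2 backward_shift.rep_eq
    by (subst suminf_split_head[OF summable_coords]) simp
  then show ?thesis by (rule power2_le_imp_le) simp
qed

lemma linear_scaled_backward_shift:
  "Vector_Spaces.linear scale_ell2 scale_ell2 (\<lambda>x. scale_ell2 c (backward_shift x))"
  unfolding Vector_Spaces.linear_iff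
  by (intro conjI allI vector_space_scale_ell2) (transfer; simp add: fun_eq_iff algebra_simps)+

lemma bounded_linear_scaled_backward_shift:
  "bounded_linear (\<lambda>x. scale_ell2 c (backward_shift x))"
proof (rule bounded_linear_intro)
  show "scale_ell2 c (backward_shift (x + y)) =
      scale_ell2 c (backward_shift x) + scale_ell2 c (backward_shift y)" for x y
    by transfer (simp add: fun_eq_iff algebra_simps)
  show "scale_ell2 c (backward_shift (r *\<^sub>R x)) = r *\<^sub>R scale_ell2 c (backward_shift x)" for r x
    unfolding scaleR_ell2_def by transfer (simp add: fun_eq_iff algebra_simps)
  show "norm (scale_ell2 c (backward_shift x)) \<le> norm x * cmod c" for x
    using norm_backward_shift_le[of x]
    by (simp add: norm_scale_ell2 mult.commute[of _ "cmod c"] mult_left_mono)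
qed

lemma coords_scaled_backward_shift_power:
  "coords (((\<lambda>x. scale_ell2 c (backward_shift x)) ^^ n) x) k = c ^ n * coords x (k + n)"
  by (induction n arbitrary: k) (simp_all add: scale_ell2.rep_eq backward_shift.rep_eq)

lemma scaled_backward_shift_power_truncation:
  assumes "n \<ge> N"
  shows "((\<lambda>x. scale_ell2 c (backward_shift x)) ^^ n) (truncation N x) = 0"
  by (rule coords_inject[THEN iffD1])
    (use assms in \<open>simp add: fun_eq_iff coords_scaled_backward_shift_power coords_truncation
      zero_ell2.rep_eq\<close>)

lemma scaled_backward_shift_power_truncation_tendsto:
  "(\<lambda>n. ((\<lambda>x. scale_ell2 c (backward_shift x)) ^^ n) (truncation N x)) \<longlonglongrightarrow> 0"
  by (intro tendsto_eventually eventually_sequentiallyI[of N]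
      scaled_backward_shift_power_truncation)

lemma norm_scaled_forward_shift_power:
  "norm (((\<lambda>x. scale_ell2 c (forward_shift x)) ^^ n) x) = cmod c ^ n * norm x"
  by (induction n) (simp_all add: norm_scale_ell2 norm_forward_shift)

lemma scaled_forward_shift_power_tendsto:
  assumes "cmod c < 1"
  shows "(\<lambda>n. ((\<lambda>x. scale_ell2 c (forward_shift x)) ^^ n) x) \<longlonglongrightarrow> 0"
proof (rule tendsto_norm_zero_cancel)
  have "(\<lambda>n. cmod c ^ n) \<longlonglongrightarrow> 0"
    using assms by (intro LIMSEQ_realpow_zero) auto
  then show "(\<lambda>n. norm (((\<lambda>x. scale_ell2 c (forward_shift x)) ^^ n) x)) \<longlonglongrightarrow> 0"
    unfolding norm_scaled_forward_shift_power by (rule tendsto_mult_left_zero)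
qed

lemma scaled_backward_forward_shift:
  assumes "c \<noteq> 0"
  shows "scale_ell2 c (backward_shift (scale_ell2 (inverse c) (forward_shift x))) = x"
proof -
  interpret vector_space scale_ell2 by (rule vector_space_scale_ell2)
  show ?thesis using assms by (simp add: backward_shift_scale backward_forward_shift)
qed


section \<open>Delta-hypercyclicity of the scaled backward shift\<close>

text \<open>A set passing within \<open>\<delta>\<close> of every point is \<open>\<delta>\<close>-dense, since a point of an open set
  bounds the infimum over that set.\<close>

lemma (in separable_metric_tvs) delta_denseI:
  assumes "\<And>y. \<exists>x\<in>A. dist x y < \<delta>"
  shows "delta_dense \<delta> A"
  unfolding delta_dense_def delta_neighbourhood_def
proof (intro allI impI)
  fix U :: "'a set" assume "U \<noteq> {}"
  then obtain y where y: "y \<in> U" by blast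
  obtain x where x: "x \<in> A" "dist x y < \<delta>" using assms by blast
  have "(INF y\<in>U. dist x y) \<le> dist x y"
    by (rule cINF_lower[OF _ y]) (rule bdd_belowI2[of _ 0], simp)
  with x show "A \<inter> {x. (INF y\<in>U. dist x y) < \<delta>} \<noteq> {}" by force
qed

theorem proposition4p7:
  fixes lam :: complex
  assumes "cmod lam > 1"
  shows "(\<forall>\<delta>>0. ell2.delta_hypercyclicity_criterion \<delta>
                  (\<lambda>x. scale_ell2 lam (backward_shift x)) (\<lambda>k. k)) \<and>
         (\<forall>\<delta>>0. ell2.delta_hypercyclic \<delta> (\<lambda>x. scale_ell2 lam (backward_shift x)))"
proof -
  define T where "T = (\<lambda>x. scale_ell2 lam (backward_shift x))"
  define S where "S = (\<lambda>x. scale_ell2 (inverse lam) (forward_shift x))"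
  obtain D where D: "countable D" "closure D = UNIV"
    and trunc: "\<And>w. w \<in> D \<Longrightarrow> \<exists>N x. w = truncation N x"
    using countable_dense_truncations by blast
  have T0: "(\<lambda>n. (T ^^ n) w) \<longlonglongrightarrow> 0" if "w \<in> D" for w
    using trunc[OF that] scaled_backward_shift_power_truncation_tendsto
    unfolding T_def by blast
  have S0: "(\<lambda>n. (S ^^ n) w) \<longlonglongrightarrow> 0" for w
    unfolding S_def using assms
    by (intro scaled_forward_shift_power_tendsto) (simp add: norm_inverse inverse_less_1_iff)
  have TS: "T (S x) = x" for x
    unfolding T_def S_def using assms by (intro scaled_backward_forward_shift) auto
  have bl: "bounded_linear T"
    unfolding T_def by (rule bounded_linear_scaled_backward_shift)
  have op: "ell2.continuous_linear_operator T"
    unfolding ell2.continuous_linear_operator_def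
    using linear_continuous_on[OF bl] linear_scaled_backward_shift[of lam] by (simp add: T_def)
  have "ell2.delta_hypercyclicity_criterion \<delta> T (\<lambda>k. k)" if "\<delta> > 0" for \<delta>
    unfolding ell2.delta_hypercyclicity_criterion_def
  proof (intro conjI op exI[of _ D] exI[of _ "\<lambda>k. S ^^ k"])
    show "\<forall>w\<in>D. \<exists>k0. \<forall>k\<ge>k0. dist ((T ^^ k) ((S ^^ k) w)) w < \<delta>"
      using funpow_right_inverse[of T S, OF TS] \<open>\<delta> > 0\<close> by simp
  qed (use D T0 S0 in \<open>auto simp: strict_mono_def\<close>)
  moreover have "ell2.delta_hypercyclic \<delta> T" if "\<delta> > 0" for \<delta>
  proof -
    have "\<delta> / 2 > 0" using that by simp
    then obtain x where x: "\<And>w. w \<in> D \<Longrightarrow> \<exists>n. dist ((T ^^ n) x) w \<le> \<delta> / 2"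
      using approximating_orbit_exists[OF bl TS D(1) T0 S0] by blast
    have "\<exists>z\<in>range (\<lambda>n. (T ^^ n) x). dist z y < \<delta>" for y
    proof -
      obtain w where w: "w \<in> D" "dist w y < \<delta> / 2"
        using D(2) \<open>\<delta> / 2 > 0\<close> closure_approachable[of y D] by blast
      obtain n where "dist ((T ^^ n) x) w \<le> \<delta> / 2" using x[OF w(1)] by blast
      then have "dist ((T ^^ n) x) y < \<delta>"
        using w(2) dist_triangle[of "(T ^^ n) x" y w] by linarith
      then show ?thesis by blast
    qed
    then have "ell2.delta_dense \<delta> (range (\<lambda>n. (T ^^ n) x))"
      by (rule ell2.delta_denseI)
    then show ?thesis
      unfolding ell2.delta_hypercyclic_def using op by blast
  qed
  ultimately show ?thesis unfolding T_def by blast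
qed

end
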